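(* Let $D$ be a domain presented by a language $L$ with a computable numbering of its systems, such that $L$ contains, for each $b\in\{0,1\}$, a system of constant behaviour $b$. There is a $\nu$-index $\delta$, depending only on $L$ (and the numbering $\nu$ of $L^{+}$), such that the following hold. (1) For every $X\subseteq\mathbb{N}$ and every partial $X$-computable $\alpha$, the domain $D^{+}_\alpha$ carries the full trichotomy at $\delta$: $\nu(\delta)\in\mathbf{M}_{D^{+}_\alpha}\iff\alpha(\delta)\!\downarrow=1$; exactly one of (i) $\alpha(\delta)\!\downarrow=1$, (ii) $\alpha(\delta)\!\downarrow\ne1$, (iii) $\alpha(\delta)\!\uparrow$ holds; $\alpha$ is not simultaneously total, exhaustive and sound on $D^{+}_\alpha$; and the three failure modes are exactly (i)–(iii), with (i) refuting soundness, (ii) refuting exhaustiveness and (iii) refuting totality. (2) In particular, if $\alpha=v$ is total, case (iii) is excluded and $v$ is not both exhaustive and sound on $D^{+}_v$. (3) No such domain $D$ that is ask-closed for a correct total adjudicator of itself is decidable.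
   Context: A domain $D$ consists of distinctions (here: the systems of a language $L$, numbered by natural numbers) with a manifestation predicate $\mathbf{M}_D$; a system of constant behaviour $1$ (mark) manifests and one of constant behaviour $0$ (void) does not. $D$ is decidable if its manifestation problem $\{p\in D: p\in\mathbf{M}_D\}$ is decidable. A partial function $\alpha$ on $\mathbb{N}$ is used as an adjudicator: it annuls $p$ if $\alpha(p)\!\downarrow=1$, exempts $p$ if $\alpha(p)\!\downarrow\neq1$, and is silent on $p$ if $\alpha(p)\!\uparrow$. On a domain it is total if silent on no distinction of the domain; exhaustive if it annuls every distinction of the domain; sound if it annuls no manifesting distinction of the domain. A total adjudicator is correct for a domain if it annuls exactly the non-manifesting distinctions of the domain. Ask-extension. Let $L^{+}$ be the language obtained by adjoining to $L$ a single nullary gate $\mathrm{ask}$, as a syntactic symbol. $L^{+}$ is a decidable set of finite syntactic objects; fix once and for all a computable numbering $\nu:\mathbb{N}\to L^{+}$ of it, extending that of $L$ and independent of any semantics. For a partial function $\alpha$ on $\mathbb{N}$, the ask-extension $D^{+}_\alpha$ is the domain whose systems are those of $L^{+}$, evaluated as in $L$ except that in the system $\nu(p)$ every occurrence of $\mathrm{ask}$ evaluates to the mark if $\alpha(p)\!\downarrow=1$, to the void if $\alpha(p)\!\downarrow\neq1$, and diverges if $\alpha(p)\!\uparrow$ (a system whose evaluation diverges does not manifest). The distinctions of $D^{+}_\alpha$ are referred to by their $\nu$-indices $p$, and $\alpha$ acts on $D^{+}_\alpha$ through these indices. $L^{+}$ contains in particular the system that evaluates $\mathrm{ask}$ and then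 behaves as the constant it names. $D$ is ask-closed for $\alpha$ if $D^{+}_\alpha\subseteq D$ up to a computable translation $t$ respecting both manifestation and verdicts, i.e. $\nu(p)\in\mathbf{M}_{D^{+}_\alpha}\iff t(p)\in\mathbf{M}_D$ and $\alpha(t(p))\simeq\alpha(p)$ for all $p$ (where $t(p)$ is a distinction of $D$, and $\simeq$ means both sides are undefined or both are defined and equal). *)

theory Defs
  imports "HOL-Library.Nat_Bijection"
begin

section \<open>Relative computability on the natural numbers\<close>

text \<open>
  Kleene's schemes relative to the characteristic function of a set \<open>X\<close>.  Programs carry
  no arity; a program applied to an argument list of unsuitable length has no value.
\<close>

datatype prog =
    Zero
  | Succ
  | Proj nat
  | Oracle
  | Comp prog "prog list"
  | PrimRec prog prog
  | Mu prog

inductive computes :: "nat set \<Rightarrow> prog \<Rightarrow> nat list \<Rightarrow> nat \<Rightarrow> bool" for X :: "nat set" where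
  zero: "computes X Zero xs 0"
| succ: "computes X Succ [x] (Suc x)"
| proj: "i < length xs \<Longrightarrow> computes X (Proj i) xs (xs ! i)"
| orac: "computes X Oracle [x] (if x \<in> X then 1 else 0)"
| comp: "length ys = length gs \<Longrightarrow> (\<forall>i < length gs. computes X (gs ! i) xs (ys ! i)) \<Longrightarrow>
    computes X f ys z \<Longrightarrow> computes X (Comp f gs) xs z"
| rec_0: "computes X f xs z \<Longrightarrow> computes X (PrimRec f g) (0 # xs) z"
| rec_Suc: "computes X (PrimRec f g) (n # xs) y \<Longrightarrow> computes X g (n # y # xs) z \<Longrightarrow>
    computes X (PrimRec f g) (Suc n # xs) z"
| mu: "computes X f (n # xs) 0 \<Longrightarrow> (\<forall>m < n. \<exists>k. computes X f (m # xs) (Suc k)) \<Longrightarrow>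
    computes X (Mu f) xs n"

definition partial_computable_in :: "nat set \<Rightarrow> (nat \<Rightarrow> nat option) \<Rightarrow> bool" where
  "partial_computable_in X \<alpha> \<longleftrightarrow> (\<exists>r. \<forall>x y. computes X r [x] y \<longleftrightarrow> \<alpha> x = Some y)"

definition computable_on :: "nat set \<Rightarrow> (nat \<Rightarrow> nat) \<Rightarrow> bool" where
  "computable_on A f \<longleftrightarrow> (\<exists>r. \<forall>x\<in>A. computes {} r [x] (f x))"

definition decidable_set :: "nat set \<Rightarrow> bool" where
  "decidable_set A \<longleftrightarrow> computable_on UNIV (\<lambda>x. if x \<in> A then 1 else 0)"


section \<open>Domains and adjudicators\<close>

record distinction_domain =
  distinctions :: "nat set"
  manifesting :: "nat set"

definition decidable_domain :: "distinction_domain \<Rightarrow> bool" where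
  "decidable_domain D \<longleftrightarrow> decidable_set {p \<in> distinctions D. p \<in> manifesting D}"

text \<open>In a partial function \<open>\<alpha>\<close>, \<open>None\<close> is divergence.\<close>

definition annuls :: "(nat \<Rightarrow> nat option) \<Rightarrow> nat \<Rightarrow> bool" where
  "annuls \<alpha> p \<longleftrightarrow> \<alpha> p = Some 1"

definition exempts :: "(nat \<Rightarrow> nat option) \<Rightarrow> nat \<Rightarrow> bool" where
  "exempts \<alpha> p \<longleftrightarrow> (\<exists>v. \<alpha> p = Some v \<and> v \<noteq> 1)"

definition silent :: "(nat \<Rightarrow> nat option) \<Rightarrow> nat \<Rightarrow> bool" where
  "silent \<alpha> p \<longleftrightarrow> \<alpha> p = None"

definition total_adj :: "distinction_domain \<Rightarrow> (nat \<Rightarrow> nat option) \<Rightarrow> bool" where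
  "total_adj D \<alpha> \<longleftrightarrow> (\<forall>p \<in> distinctions D. \<not> silent \<alpha> p)"

definition exhaustive_adj :: "distinction_domain \<Rightarrow> (nat \<Rightarrow> nat option) \<Rightarrow> bool" where
  "exhaustive_adj D \<alpha> \<longleftrightarrow> (\<forall>p \<in> distinctions D. annuls \<alpha> p)"

definition sound_adj :: "distinction_domain \<Rightarrow> (nat \<Rightarrow> nat option) \<Rightarrow> bool" where
  "sound_adj D \<alpha> \<longleftrightarrow> (\<forall>p \<in> distinctions D. p \<in> manifesting D \<longrightarrow> \<not> annuls \<alpha> p)"

definition correct_total_adj :: "distinction_domain \<Rightarrow> (nat \<Rightarrow> nat option) \<Rightarrow> bool" where
  "correct_total_adj D \<alpha> \<longleftrightarrow>
     total_adj D \<alpha> \<and> (\<forall>p \<in> distinctions D. annuls \<alpha> p \<longleftrightarrow> p \<notin> manifesting D)"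

text \<open>Failure of each requirement at one given distinction.\<close>

definition totality_fails_at where
  "totality_fails_at D \<alpha> p \<longleftrightarrow> p \<in> distinctions D \<and> silent \<alpha> p"

definition exhaustiveness_fails_at where
  "exhaustiveness_fails_at D \<alpha> p \<longleftrightarrow> p \<in> distinctions D \<and> \<not> annuls \<alpha> p"

definition soundness_fails_at where
  "soundness_fails_at D \<alpha> p \<longleftrightarrow> p \<in> distinctions D \<and> p \<in> manifesting D \<and> annuls \<alpha> p"


section \<open>Languages of gates\<close>

text \<open>
  Systems are finite trees of gates, possibly with occurrences of the extra nullary gate
  \<open>Ask\<close>; gate names are natural numbers.
\<close>

datatype sys = Ask | Gate nat "sys list"

primrec code :: "sys \<Rightarrow> nat" where
  "code Ask = 0"
| "code (Gate g ss) = Suc (prod_encode (g, list_encode (map code ss)))"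

text \<open>
  Behaviours form an arbitrary type \<open>'b\<close> and the evaluation of a system is of type
  \<open>'b option\<close>, \<open>None\<close> being divergence.  A gate is interpreted by a function of the outcomes of
  its arguments and need not be strict, so it may ignore a diverging argument.  The fields
  \<open>mark\<close> and \<open>void\<close> are the constant behaviours 1 and 0.
\<close>

record 'b language =
  ranks :: "nat \<Rightarrow> nat set"
  interp :: "nat \<Rightarrow> 'b option list \<Rightarrow> 'b option"
  mark :: 'b
  void :: 'b

inductive_set systems_plus :: "'b language \<Rightarrow> sys set" for L :: "'b language" where
  ask: "Ask \<in> systems_plus L"
| gate: "length ss \<in> ranks L g \<Longrightarrow> (\<forall>s \<in> set ss. s \<in> systems_plus L) \<Longrightarrow>
    Gate g ss \<in> systems_plus L"

inductive_set systems :: "'b language \<Rightarrow> sys set" for L :: "'b language" where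
  gate: "length ss \<in> ranks L g \<Longrightarrow> (\<forall>s \<in> set ss. s \<in> systems L) \<Longrightarrow>
    Gate g ss \<in> systems L"

text \<open>The parameter \<open>a\<close> is the outcome of every occurrence of \<open>Ask\<close>.\<close>

primrec eval_plus :: "'b language \<Rightarrow> 'b option \<Rightarrow> sys \<Rightarrow> 'b option" where
  "eval_plus L a Ask = a"
| "eval_plus L a (Gate g ss) = interp L g (map (eval_plus L a) ss)"

text \<open>Systems of \<open>L\<close> contain no \<open>Ask\<close>, so the outcome supplied for it is irrelevant.\<close>

definition eval :: "'b language \<Rightarrow> sys \<Rightarrow> 'b option" where
  "eval L s = eval_plus L None s"

lemma eval_plus_systems: "s \<in> systems L \<Longrightarrow> eval_plus L a s = eval L s"
proof (induction rule: systems.induct)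
  case (gate ss g)
  then have "map (eval_plus L a) ss = map (eval_plus L None) ss"
    by (simp add: eval_def)
  then show ?case by (simp add: eval_def del: map_eq_conv)
qed

definition has_constants :: "'b language \<Rightarrow> bool" where
  "has_constants L \<longleftrightarrow>
     (\<exists>s \<in> systems L. eval L s = Some (mark L)) \<and> (\<exists>s \<in> systems L. eval L s = Some (void L))"

text \<open>
  A numbering has an index set \<open>A\<close>, which for the systems of \<open>L\<close> may be a proper subset of the
  natural numbers; it need not be injective.
\<close>

definition computable_numbering :: "nat set \<Rightarrow> (nat \<Rightarrow> sys) \<Rightarrow> sys set \<Rightarrow> bool" where
  "computable_numbering A \<nu> S \<longleftrightarrow>
     decidable_set A \<and> computable_on A (\<lambda>p. code (\<nu> p)) \<and> \<nu> ` A = S"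

text \<open>
  \<open>\<nu>\<close> extends \<open>\<mu>\<close> along a computable change \<open>e\<close> of indices.  Literal extension is the case
  where \<open>e\<close> is the identity; it is not possible when \<open>A\<close> is already all of the natural numbers.
\<close>

definition extends_numbering :: "(nat \<Rightarrow> sys) \<Rightarrow> nat set \<Rightarrow> (nat \<Rightarrow> sys) \<Rightarrow> bool" where
  "extends_numbering \<nu> A \<mu> \<longleftrightarrow>
     (\<exists>e. computable_on A e \<and> (\<forall>i \<in> A. \<nu> (e i) = \<mu> i))"


section \<open>Domains presented by a language, and their ask-extensions\<close>

text \<open>
  Manifestation is given by the set \<open>B\<close> of manifesting behaviours; a diverging system does not
  manifest.
\<close>

definition manifestation :: "'b language \<Rightarrow> 'b set \<Rightarrow> bool" where
  "manifestation L B \<longleftrightarrow> mark L \<in> B \<and> void L \<notin> B"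

definition presented_domain ::
    "'b language \<Rightarrow> 'b set \<Rightarrow> nat set \<Rightarrow> (nat \<Rightarrow> sys) \<Rightarrow> distinction_domain" where
  "presented_domain L B A \<mu> =
     \<lparr>distinctions = A, manifesting = {p \<in> A. \<exists>b \<in> B. eval L (\<mu> p) = Some b}\<rparr>"

definition ask_value :: "'b language \<Rightarrow> (nat \<Rightarrow> nat option) \<Rightarrow> nat \<Rightarrow> 'b option" where
  "ask_value L \<alpha> p =
     (case \<alpha> p of None \<Rightarrow> None | Some v \<Rightarrow> Some (if v = 1 then mark L else void L))"

definition ask_extension ::
    "'b language \<Rightarrow> 'b set \<Rightarrow> (nat \<Rightarrow> sys) \<Rightarrow> (nat \<Rightarrow> nat option) \<Rightarrow> distinction_domain" where
  "ask_extension L B \<nu> \<alpha> =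
     \<lparr>distinctions = UNIV, manifesting = {p. \<exists>b \<in> B. eval_plus L (ask_value L \<alpha> p) (\<nu> p) = Some b}\<rparr>"

definition ask_closed ::
    "'b language \<Rightarrow> 'b set \<Rightarrow> (nat \<Rightarrow> sys) \<Rightarrow> distinction_domain \<Rightarrow> (nat \<Rightarrow> nat option) \<Rightarrow> bool"
  where
  "ask_closed L B \<nu> D \<alpha> \<longleftrightarrow>
     (\<exists>t. computable_on UNIV t \<and>
        (\<forall>p. t p \<in> distinctions D \<and>
             (p \<in> manifesting (ask_extension L B \<nu> \<alpha>) \<longleftrightarrow> t p \<in> manifesting D) \<and>
             \<alpha> (t p) = \<alpha> p))"

end

theory Submission
  imports Defs
begin

text \<open>The diagonal system is the bare gate \<open>Ask\<close>, and \<delta> is any index of it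
  under \<nu>. In the ask-extension this system behaves as the verdict of \<alpha> on its own index
  dictates, so it manifests exactly when it is annulled
  (\<open>manifesting_ask_extension_Ask\<close>). Annulling \<delta> is therefore unsound, exempting
  it breaks exhaustiveness, and silence breaks totality; no fixed-point theorem is involved. For a
  correct total adjudicator, ask-closure carries this self-reference into the domain itself, where
  correctness demands the opposite equivalence
  (\<open>not_ask_closed_correct_total_adj\<close>).\<close>

text \<open>The three possible outcomes of \<open>Ask\<close> are the mark, which lies in
  \<open>B\<close>, the void, which does not, and divergence, which never manifests. Only the
  verdict 1 yields the mark.\<close>

lemma manifesting_ask_extension_Ask:
  assumes "manifestation L B" "\<nu> \<delta> = Ask"
  shows "\<delta> \<in> manifesting (ask_extension L B \<nu> \<alpha>) \<longleftrightarrow> \<alpha> \<delta> = Some 1"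
  using assms
  by (auto simp: ask_extension_def ask_value_def manifestation_def split: option.splits)

lemma distinctions_ask_extension [simp]: "distinctions (ask_extension L B \<nu> \<alpha>) = UNIV"
  by (simp add: ask_extension_def)

text \<open>A liar argument: the translate of \<delta> would manifest if and only if it does
  not.\<close>

lemma not_ask_closed_correct_total_adj:
  assumes "manifestation L B" "\<nu> \<delta> = Ask" "correct_total_adj D \<alpha>"
  shows "\<not> ask_closed L B \<nu> D \<alpha>"
proof
  assume "ask_closed L B \<nu> D \<alpha>"
  then obtain t where t: "t \<delta> \<in> distinctions D"
      "\<delta> \<in> manifesting (ask_extension L B \<nu> \<alpha>) \<longleftrightarrow> t \<delta> \<in> manifesting D"
      "\<alpha> (t \<delta>) = \<alpha> \<delta>"
    unfolding ask_closed_def by blast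
  have "annuls \<alpha> (t \<delta>) \<longleftrightarrow> t \<delta> \<notin> manifesting D"
    using assms(3) t(1) unfolding correct_total_adj_def by blast
  \<comment> \<open>The translation preserves both sides of the equivalence at \<delta>: the verdict
    and manifestation.\<close>
  moreover have "annuls \<alpha> (t \<delta>) \<longleftrightarrow> t \<delta> \<in> manifesting D"
    using manifesting_ask_extension_Ask[of L B \<nu> \<delta> \<alpha>] assms(1,2) t(2,3) by (metis annuls_def)
  ultimately show False
    by blast
qed

theorem theorem4p7:
  fixes L :: "'b language" and \<nu> :: "nat \<Rightarrow> sys"
  assumes "has_constants L"
    and "decidable_set (code ` systems_plus L)"
    and "computable_numbering UNIV \<nu> (systems_plus L)"
  shows "\<exists>\<delta>::nat. \<forall>(B :: 'b set) (A :: nat set) (\<mu> :: nat \<Rightarrow> sys).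
    manifestation L B \<longrightarrow> computable_numbering A \<mu> (systems L) \<longrightarrow> extends_numbering \<nu> A \<mu> \<longrightarrow>
    (\<forall>(X :: nat set) (\<alpha> :: nat \<Rightarrow> nat option). partial_computable_in X \<alpha> \<longrightarrow>
       (let D\<^sub>\<alpha> = ask_extension L B \<nu> \<alpha> in
          (\<delta> \<in> manifesting D\<^sub>\<alpha> \<longleftrightarrow> \<alpha> \<delta> = Some 1) \<and>
          ((annuls \<alpha> \<delta> \<and> \<not> exempts \<alpha> \<delta> \<and> \<not> silent \<alpha> \<delta>) \<or>
           (\<not> annuls \<alpha> \<delta> \<and> exempts \<alpha> \<delta> \<and> \<not> silent \<alpha> \<delta>) \<or>
           (\<not> annuls \<alpha> \<delta> \<and> \<not> exempts \<alpha> \<delta> \<and> silent \<alpha> \<delta>)) \<and>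
          \<not> (total_adj D\<^sub>\<alpha> \<alpha> \<and> exhaustive_adj D\<^sub>\<alpha> \<alpha> \<and> sound_adj D\<^sub>\<alpha> \<alpha>) \<and>
          (soundness_fails_at D\<^sub>\<alpha> \<alpha> \<delta> \<longleftrightarrow> annuls \<alpha> \<delta>) \<and>
          (exhaustiveness_fails_at D\<^sub>\<alpha> \<alpha> \<delta> \<and> \<not> totality_fails_at D\<^sub>\<alpha> \<alpha> \<delta> \<longleftrightarrow> exempts \<alpha> \<delta>) \<and>
          (totality_fails_at D\<^sub>\<alpha> \<alpha> \<delta> \<longleftrightarrow> silent \<alpha> \<delta>) \<and>
          (annuls \<alpha> \<delta> \<longrightarrow> \<not> sound_adj D\<^sub>\<alpha> \<alpha>) \<and>
          (exempts \<alpha> \<delta> \<longrightarrow> \<not> exhaustive_adj D\<^sub>\<alpha> \<alpha>) \<and>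
          (silent \<alpha> \<delta> \<longrightarrow> \<not> total_adj D\<^sub>\<alpha> \<alpha>))) \<and>
    (\<forall>(X :: nat set) (v :: nat \<Rightarrow> nat option). partial_computable_in X v \<longrightarrow>
       (let D\<^sub>v = ask_extension L B \<nu> v in
          total_adj D\<^sub>v v \<longrightarrow> \<not> silent v \<delta> \<and> \<not> (exhaustive_adj D\<^sub>v v \<and> sound_adj D\<^sub>v v))) \<and>
    (let D = presented_domain L B A \<mu> in
       \<forall>\<alpha> :: nat \<Rightarrow> nat option.
         correct_total_adj D \<alpha> \<longrightarrow> ask_closed L B \<nu> D \<alpha> \<longrightarrow> \<not> decidable_domain D)"
proof -
  \<comment> \<open>Surjectivity of \<nu> supplies \<delta> before \<open>B\<close>,
    \<open>A\<close>, \<mu>, \<open>X\<close> and \<alpha> are fixed, so one index serves them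
    all.\<close>
  from assms(3) have "Ask \<in> range \<nu>"
    by (simp add: computable_numbering_def systems_plus.ask)
  then obtain \<delta> where \<delta>: "\<nu> \<delta> = Ask"
    by (metis imageE)
  show ?thesis
  proof (intro exI[of _ \<delta>] allI impI conjI, goal_cases)
    case (1 B A \<mu> X \<alpha>)
    let ?D = "ask_extension L B \<nu> \<alpha>"
    have man: "\<delta> \<in> manifesting ?D \<longleftrightarrow> \<alpha> \<delta> = Some 1"
      using 1 \<delta> by (simp add: manifesting_ask_extension_Ask)
    have "annuls \<alpha> \<delta> \<Longrightarrow> \<not> sound_adj ?D \<alpha>"
      using man unfolding sound_adj_def annuls_def by auto
    moreover have "exempts \<alpha> \<delta> \<Longrightarrow> \<not> exhaustive_adj ?D \<alpha>"
      unfolding exhaustive_adj_def exempts_def annuls_def by force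
    moreover have "silent \<alpha> \<delta> \<Longrightarrow> \<not> total_adj ?D \<alpha>"
      unfolding total_adj_def by auto
    moreover have "soundness_fails_at ?D \<alpha> \<delta> \<longleftrightarrow> annuls \<alpha> \<delta>"
      using man by (simp add: soundness_fails_at_def annuls_def)
    moreover have "exhaustiveness_fails_at ?D \<alpha> \<delta> \<longleftrightarrow> \<not> annuls \<alpha> \<delta>"
      by (simp add: exhaustiveness_fails_at_def)
    moreover have "totality_fails_at ?D \<alpha> \<delta> \<longleftrightarrow> silent \<alpha> \<delta>"
      by (simp add: totality_fails_at_def)
    moreover have "annuls \<alpha> \<delta> \<and> \<not> exempts \<alpha> \<delta> \<and> \<not> silent \<alpha> \<delta> \<or>
        \<not> annuls \<alpha> \<delta> \<and> exempts \<alpha> \<delta> \<and> \<not> silent \<alpha> \<delta> \<or>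
        \<not> annuls \<alpha> \<delta> \<and> \<not> exempts \<alpha> \<delta> \<and> silent \<alpha> \<delta>"
      by (cases "\<alpha> \<delta>") (auto simp: annuls_def exempts_def silent_def)
    \<comment> \<open>Exhaustiveness also fails under silence; excluding a failure of totality
      leaves, by the trichotomy, exactly exemption.\<close>
    ultimately show ?case
      using man unfolding Let_def by argo
  next
    case (2 B A \<mu> X v)
    let ?D = "ask_extension L B \<nu> v"
    have "\<delta> \<in> manifesting ?D \<longleftrightarrow> annuls v \<delta>"
      using 2 \<delta> by (simp add: manifesting_ask_extension_Ask annuls_def)
    \<comment> \<open>Exhaustiveness annuls \<delta>, which then manifests, and soundness forbids
      this.\<close>
    then have "\<not> (exhaustive_adj ?D v \<and> sound_adj ?D v)"
      unfolding exhaustive_adj_def sound_adj_def by auto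
    then show ?case
      unfolding Let_def total_adj_def by simp
  next
    case (3 B A \<mu>)
    \<comment> \<open>The two assumptions on \<alpha>, correctness and ask-closure, already
      contradict each other.\<close>
    then show ?case
      using not_ask_closed_correct_total_adj[of L B \<nu> \<delta>] \<delta> unfolding Let_def by blast
  qed
qed

end
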